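(* For every integer $k\geq 0$ and every real number $\delta\in\left[0,\frac{10^{-8}}{(k+2)!^2}\right]$, there exists a constant $d_0>0$ such that the following holds for all integers $d\geq d_0$. Let $H$ be a $(1\pm\delta)d$-regular bipartite graph with bipartition $X\cup Y$, where $|X|=|Y|=n$. Let $H'$ be the output graph of the $(X,Y;H)$-model, and let $I_k$ be the number of vertices of $Y$ having degree exactly $k$ in $H'$. Then for every $\gamma\geq 600(k+1)\sqrt{\delta}$, $$\Pr\left[\left|I_k-\frac{e^{-1}}{k!}n\right|>\gamma n\right]\leq 10\,e^{-\frac{(\gamma-600(k+1)\sqrt{\delta})^2}{32(k+1)}n}.$$
   Context: For constants $d,\delta>0$, a graph is called $(1\pm\delta)d$-regular if every vertex degree lies in $[(1-\delta)d,(1+\delta)d]$. Given a bipartite graph $H$ with bipartition $X\cup Y$, the $(X,Y;H)$-model is the following random process: independently for each vertex $x\in X$, choose a vertex $y\in N_H(x)$ uniformly at random and put $xy$ as an edge of a random subgraph $H'$ of $H$ (with vertex set $X\cup Y$). The random graph $H'$ so obtained is called the output graph of the $(X,Y;H)$-model.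
   Formalization: The formal theorem takes (1±δ)d-regular to require δ>0, so the endpoint δ=0 is vacuous; read as exactly d-regular, the claim fails there (many disjoint copies of K_{d,d} give I_k/n tending to a rational number, not e^{-1}/k!). *)

theory Defs
  imports "HOL-Probability.Probability"
begin

type_synonym 'a graph = "'a set \<times> 'a set set"

abbreviation verts :: "'a graph \<Rightarrow> 'a set" where
  "verts G \<equiv> fst G"

abbreviation edges :: "'a graph \<Rightarrow> 'a set set" where
  "edges G \<equiv> snd G"

definition simple_graph :: "'a graph \<Rightarrow> bool" where
  "simple_graph G \<longleftrightarrow>
     finite (verts G) \<and> (\<forall>e\<in>edges G. e \<subseteq> verts G \<and> card e = 2)"

definition neighborhood :: "'a graph \<Rightarrow> 'a \<Rightarrow> 'a set" where
  "neighborhood G v = {u. {v, u} \<in> edges G}"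

definition degree :: "'a graph \<Rightarrow> 'a \<Rightarrow> nat" where
  "degree G v = card {e \<in> edges G. v \<in> e}"

definition bipartition :: "'a graph \<Rightarrow> 'a set \<Rightarrow> 'a set \<Rightarrow> bool" where
  "bipartition G X Y \<longleftrightarrow>
     X \<inter> Y = {} \<and> X \<union> Y = verts G \<and> (\<forall>e\<in>edges G. \<exists>x\<in>X. \<exists>y\<in>Y. e = {x, y})"

text \<open>
  A graph is \<open>(1 \<plusminus> \<delta>)d\<close>-regular only for constants \<open>d, \<delta> > 0\<close>; positivity is part of the
  notion, so no graph is \<open>nearly_regular\<close> with \<open>\<delta> = 0\<close>.
\<close>
definition nearly_regular :: "real \<Rightarrow> real \<Rightarrow> 'a graph \<Rightarrow> bool" where
  "nearly_regular \<delta> d G \<longleftrightarrow> d > 0 \<and> \<delta> > 0 \<and>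
     (\<forall>v\<in>verts G. real (degree G v) \<in> {(1 - \<delta>) * d .. (1 + \<delta>) * d})"

text \<open>
  The law of the output graph of the \<open>(X,Y;H)\<close>-model: \<open>f x\<close> is the neighbor chosen by \<open>x\<close>.
  The value \<open>undefined\<close> is what \<open>f\<close> takes outside \<open>X\<close> and plays no role.  The model is
  meaningful only if every \<open>x \<in> X\<close> has a neighbor (\<open>pmf_of_set {}\<close> is unspecified).
\<close>
definition output_graph :: "'a set \<Rightarrow> 'a set \<Rightarrow> 'a graph \<Rightarrow> 'a graph pmf" where
  "output_graph X Y H =
     map_pmf (\<lambda>f. (X \<union> Y, (\<lambda>x. {x, f x}) ` X))
       (Pi_pmf X undefined (\<lambda>x. pmf_of_set (neighborhood H x)))"

definition num_deg :: "nat \<Rightarrow> 'a set \<Rightarrow> 'a graph \<Rightarrow> nat" where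
  "num_deg k Y G = card {y \<in> Y. degree G y = k}"

end

theory Submission
  imports Defs
begin

text \<open>
  Changing the choice of one vertex of \<open>X\<close> alters \<open>I\<^sub>k\<close> by at most 2, so the bounded differences
  inequality concentrates \<open>I\<^sub>k\<close> around its mean. The degree of a vertex \<open>y \<in> Y\<close> in \<open>H'\<close> is a sum of
  independent indicators with success probabilities \<open>p\<^sub>x\<close> of order \<open>1/d\<close>, whose sum is within
  \<open>3\<delta>\<close> of 1. By Le Cam's argument its law is pointwise within \<open>2 \<Sum>p\<^sub>x\<^sup>2\<close> of the Poisson law with
  the same mean, and Poisson weights are 1-Lipschitz in the parameter. Hence, once \<open>d \<ge> 3/\<delta>\<close>, the
  mean of \<open>I\<^sub>k\<close> is within \<open>4\<delta>n\<close> of \<open>e\<^sup>-\<^sup>1n/k!\<close>, well inside the allowed \<open>600(k+1)\<surd>\<delta> n\<close>.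
\<close>

section \<open>Poisson weights as functions of the parameter\<close>

definition poisson_weight :: "nat \<Rightarrow> real \<Rightarrow> real" where
  "poisson_weight k x = x ^ k / fact k * exp (- x)"

text \<open>Weight at \<open>k - 1\<close>, with value 0 at \<open>k = 0\<close>. Truncated
  subtraction would repeat the weight at 0 there; this form lets the derivative formula and the
  one-step recursion hold for every \<open>k\<close>.\<close>

definition poisson_weight_pred :: "nat \<Rightarrow> real \<Rightarrow> real" where
  "poisson_weight_pred k x = (case k of 0 \<Rightarrow> 0 | Suc j \<Rightarrow> poisson_weight j x)"

text \<open>A single term of the exponential series is at most its sum.\<close>

lemma poisson_weight_bounds:
  assumes "x \<ge> 0"
  shows "poisson_weight k x \<in> {0..1}"
proof -
  have "(\<lambda>n. x ^ n /\<^sub>R fact n) sums exp x"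
    by (rule exp_converges)
  then have "(\<Sum>n\<in>{k}. x ^ n /\<^sub>R fact n) \<le> exp x"
    using assms by (metis (no_types, lifting) finite.emptyI finite.insertI inverse_nonnegative_iff_nonnegative
        fact_ge_zero real_scaleR_def sum_le_suminf sums_iff zero_le_mult_iff zero_le_power)
  then have "x ^ k / fact k \<le> exp x"
    by (simp add: divide_inverse mult.commute)
  then show ?thesis
    using assms by (simp add: poisson_weight_def exp_minus field_simps)
qed

lemma poisson_weight_pred_bounds: "x \<ge> 0 \<Longrightarrow> poisson_weight_pred k x \<in> {0..1}"
  using poisson_weight_bounds by (auto simp: poisson_weight_pred_def split: nat.splits)

text \<open>The product rule gives a difference of two neighbouring weights, so on nonnegative
  arguments the derivative lies in \<open>[-1, 1]\<close>.\<close>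

lemma DERIV_poisson_weight:
  "(poisson_weight k has_real_derivative poisson_weight_pred k x - poisson_weight k x) (at x)"
proof (cases k)
  case 0
  show ?thesis
    unfolding poisson_weight_def[abs_def] poisson_weight_pred_def 0
    by (auto intro!: derivative_eq_intros)
next
  case (Suc j)
  have "((\<lambda>x. x ^ Suc j / fact (Suc j)) has_real_derivative real (Suc j) * x ^ j / fact (Suc j)) (at x)"
    by (rule DERIV_cong[OF DERIV_cdivide[OF DERIV_pow]]) simp
  also have "real (Suc j) * x ^ j / fact (Suc j) = x ^ j / fact j"
    by (simp del: of_nat_Suc)
  finally have "((\<lambda>x. x ^ Suc j / fact (Suc j)) has_real_derivative x ^ j / fact j) (at x)" .
  moreover have "((\<lambda>x. exp (- x)) has_real_derivative - exp (- x)) (at x)"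
    by (auto intro!: derivative_eq_intros)
  ultimately show ?thesis
    unfolding poisson_weight_def[abs_def] poisson_weight_pred_def Suc
    by (rule DERIV_cong[OF DERIV_mult]) simp
qed

lemma poisson_weight_MVT:
  assumes "x < y"
  obtains z where "x < z" "z < y"
    "poisson_weight k y - poisson_weight k x
       = (y - x) * (poisson_weight_pred k z - poisson_weight k z)"
  using MVT2[OF assms DERIV_poisson_weight] by blast

lemma poisson_weight_lipschitz:
  assumes "x \<ge> 0" "y \<ge> 0"
  shows "\<bar>poisson_weight k x - poisson_weight k y\<bar> \<le> \<bar>x - y\<bar>"
proof -
  have *: "\<bar>poisson_weight k b - poisson_weight k a\<bar> \<le> b - a" if "0 \<le> a" "a < b" for a b
  proof -
    obtain z where z: "a < z" "poisson_weight k b - poisson_weight k a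
       = (b - a) * (poisson_weight_pred k z - poisson_weight k z)"
      using \<open>a < b\<close> by (rule poisson_weight_MVT)
    have "\<bar>poisson_weight_pred k z - poisson_weight k z\<bar> \<le> 1"
      using poisson_weight_bounds[of z k] poisson_weight_pred_bounds[of z k] that z(1) by auto
    then show ?thesis
      using that by (simp add: z(2) abs_mult mult_left_le)
  qed
  show ?thesis
    using *[of x y] *[of y x] assms by (cases x y rule: linorder_cases) (auto simp: abs_minus_commute)
qed

lemma poisson_weight_pred_lipschitz:
  assumes "x \<ge> 0" "y \<ge> 0"
  shows "\<bar>poisson_weight_pred k x - poisson_weight_pred k y\<bar> \<le> \<bar>x - y\<bar>"
  using poisson_weight_lipschitz[OF assms] by (auto simp: poisson_weight_pred_def split: nat.splits)

text \<open>The subtracted term is the first-order Taylor polynomial at \<open>x\<close>. For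
  \<open>p \<le> 1\<close> it is also the weight at \<open>k\<close> of a Poisson variable with mean
  \<open>x\<close> plus an independent Bernoulli variable with mean \<open>p\<close>, so the lemma
  prices the exchange of one Bernoulli summand for a Poisson one. The mean value theorem replaces
  the increment by \<open>p\<close> times the derivative at some \<open>z\<close> within
  \<open>p\<close> of \<open>x\<close>, and the derivative is 2-Lipschitz.\<close>

lemma poisson_weight_taylor:
  assumes "x \<ge> 0" "p \<ge> 0"
  shows "\<bar>poisson_weight k (x + p)
           - (p * poisson_weight_pred k x + (1 - p) * poisson_weight k x)\<bar> \<le> 2 * p\<^sup>2"
proof (cases "p = 0")
  case False
  then obtain z where z: "x < z" "z < x + p" "poisson_weight k (x + p) - poisson_weight k x
       = (x + p - x) * (poisson_weight_pred k z - poisson_weight k z)"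
    using assms by (metis less_add_same_cancel1 order_le_less poisson_weight_MVT)
  have "\<bar>(poisson_weight_pred k z - poisson_weight k z)
      - (poisson_weight_pred k x - poisson_weight k x)\<bar> \<le> 2 * p"
    using poisson_weight_lipschitz[of z x k] poisson_weight_pred_lipschitz[of z x k] assms z(1,2)
    by linarith
  then have "p * \<bar>(poisson_weight_pred k z - poisson_weight k z)
      - (poisson_weight_pred k x - poisson_weight k x)\<bar> \<le> 2 * p\<^sup>2"
    using assms(2) by (simp add: power2_eq_square mult_left_mono flip: mult.left_commute)
  moreover have "poisson_weight k (x + p)
           - (p * poisson_weight_pred k x + (1 - p) * poisson_weight k x)
     = p * ((poisson_weight_pred k z - poisson_weight k z)
      - (poisson_weight_pred k x - poisson_weight k x))"
    using z(3) by (simp add: algebra_simps)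
  ultimately show ?thesis
    using assms(2) by (simp add: abs_mult)
qed (use assms in simp)

section \<open>Finite product distributions and Le Cam's approximation\<close>

lemma finite_set_Pi_pmf:
  assumes "finite A" "\<And>x. x \<in> A \<Longrightarrow> finite (set_pmf (q x))"
  shows "finite (set_pmf (Pi_pmf A dflt q))"
  using assms by (auto simp: set_Pi_pmf)

text \<open>Fubini for one coordinate: it drives the inductions over the index set, both for Le
  Cam's bound and for bounded differences.\<close>

lemma expectation_Pi_pmf_insert:
  fixes f :: "('a \<Rightarrow> 'b) \<Rightarrow> real"
  assumes "finite A" "x \<notin> A" "\<And>z. z \<in> insert x A \<Longrightarrow> finite (set_pmf (q z))"
  shows "measure_pmf.expectation (Pi_pmf (insert x A) dflt q) f =
    measure_pmf.expectation (q x)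
      (\<lambda>v. measure_pmf.expectation (Pi_pmf A dflt q) (\<lambda>h. f (h(x := v))))"
proof -
  have fin: "finite (set_pmf (Pi_pmf A dflt q))"
    using assms by (intro finite_set_Pi_pmf) auto
  have "Pi_pmf (insert x A) dflt q = q x \<bind> (\<lambda>v. map_pmf (\<lambda>h. h(x := v)) (Pi_pmf A dflt q))"
    using assms by (simp add: Pi_pmf_insert' map_pmf_def)
  then have "measure_pmf.expectation (Pi_pmf (insert x A) dflt q) f =
    (\<Sum>v\<in>set_pmf (q x). pmf (q x) v *\<^sub>R
        measure_pmf.expectation (map_pmf (\<lambda>h. h(x := v)) (Pi_pmf A dflt q)) f)"
    using assms fin by (simp only:) (rule pmf_expectation_bind, auto)
  also have "\<dots> = measure_pmf.expectation (q x)
      (\<lambda>v. measure_pmf.expectation (Pi_pmf A dflt q) (\<lambda>h. f (h(x := v))))"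
    using assms by (subst integral_measure_pmf[of "set_pmf (q x)"]) auto
  finally show ?thesis .
qed

lemma prob_eq_expectation_of_bool:
  "measure_pmf.prob M {x. P x} = measure_pmf.expectation M (\<lambda>x. of_bool (P x))"
proof -
  have "(\<lambda>x. of_bool (P x)) = (indicator {x. P x} :: _ \<Rightarrow> real)"
    by (auto simp: indicator_def)
  then show ?thesis by simp
qed

text \<open>One coordinate is added at a time. The new law of the count is the mixture of the old
  law at \<open>k - 1\<close> and at \<open>k\<close> with weights \<open>p x\<close> and
  \<open>1 - p x\<close>. Mixing does not enlarge the old error, and
  \<open>poisson_weight_taylor\<close> adds \<open>2 * (p x)^2\<close>.\<close>

lemma le_cam_pointwise:
  fixes P :: "'a \<Rightarrow> 'b \<Rightarrow> bool" and q :: "'a \<Rightarrow> 'b pmf"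
  assumes "finite A" "\<And>x. x \<in> A \<Longrightarrow> finite (set_pmf (q x))"
  defines "p \<equiv> \<lambda>x. measure_pmf.prob (q x) {v. P x v}"
  shows "\<bar>measure_pmf.prob (Pi_pmf A dflt q) {h. card {x \<in> A. P x (h x)} = k}
           - poisson_weight k (\<Sum>x\<in>A. p x)\<bar> \<le> 2 * (\<Sum>x\<in>A. (p x)\<^sup>2)"
  using assms(1,2)
proof (induction A arbitrary: k rule: finite_induct)
  case empty
  then show ?case
    by (cases k) (auto simp: poisson_weight_def indicator_def)
next
  case (insert x A)
  let ?E = "measure_pmf.expectation (Pi_pmf A dflt q)"
  let ?c = "\<lambda>h. card {z \<in> A. P z (h z)}"
  define Q where "Q = (\<lambda>k. measure_pmf.prob (Pi_pmf A dflt q) {h. ?c h = k})"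
  define Q' where "Q' = (\<lambda>k. case k of 0 \<Rightarrow> 0 | Suc j \<Rightarrow> Q j)"
  define L where "L = (\<Sum>z\<in>A. p z)"
  define \<epsilon> where "\<epsilon> = 2 * (\<Sum>z\<in>A. (p z)\<^sup>2)"
  have p: "0 \<le> p z" "p z \<le> 1" for z
    by (auto simp: p_def)
  have card_upd: "card {z \<in> insert x A. P z ((h(x := v)) z)} = (if P x v then Suc (?c h) else ?c h)"
    for h v
  proof -
    have "{z \<in> insert x A. P z ((h(x := v)) z)} =
        (if P x v then insert x {z \<in> A. P z (h z)} else {z \<in> A. P z (h z)})"
      using insert.hyps by auto
    then show ?thesis
      using insert.hyps by simp
  qed
  \<comment> \<open>For fixed \<open>v\<close> the count is shifted by one exactly when
    \<open>P x v\<close>. Written affinely in \<open>of_bool (P x v)\<close>, this integrates over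
    \<open>v\<close> at once.\<close>
  have step: "?E (\<lambda>h. of_bool (card {z \<in> insert x A. P z ((h(x := v)) z)} = k))
      = Q k + of_bool (P x v) * (Q' k - Q k)" for v
    unfolding card_upd Q_def Q'_def
    by (cases k) (simp_all add: prob_eq_expectation_of_bool)
  have "measure_pmf.prob (Pi_pmf (insert x A) dflt q) {h. card {z \<in> insert x A. P z (h z)} = k}
     = measure_pmf.expectation (q x) (\<lambda>v. Q k + of_bool (P x v) * (Q' k - Q k))"
    unfolding prob_eq_expectation_of_bool
    using insert by (subst expectation_Pi_pmf_insert) (simp_all only: step finite_insert, auto)
  also have "\<dots> = Q k + p x * (Q' k - Q k)"
    unfolding p_def prob_eq_expectation_of_bool
    using insert.prems by (subst Bochner_Integration.integral_add)
      (auto intro!: integrable_measure_pmf_finite)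
  finally have eq: "measure_pmf.prob (Pi_pmf (insert x A) dflt q)
      {h. card {z \<in> insert x A. P z (h z)} = k} = p x * Q' k + (1 - p x) * Q k"
    by (simp add: algebra_simps)
  have IH: "\<bar>Q j - poisson_weight j L\<bar> \<le> \<epsilon>" for j
    using insert.IH[of j] insert.prems by (simp add: Q_def L_def \<epsilon>_def)
  \<comment> \<open>Covers \<open>k = 0\<close> in \<open>IH'\<close>, where both shifted quantities
    are 0 and no induction hypothesis applies.\<close>
  have "\<epsilon> \<ge> 0"
    by (simp add: \<epsilon>_def sum_nonneg)
  then have IH': "\<bar>Q' k - poisson_weight_pred k L\<bar> \<le> \<epsilon>"
    using IH by (auto simp: Q'_def poisson_weight_pred_def split: nat.splits)
  have "\<bar>p x * (Q' k - poisson_weight_pred k L) + (1 - p x) * (Q k - poisson_weight k L)\<bar>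
      \<le> p x * \<epsilon> + (1 - p x) * \<epsilon>"
    using p[of x] IH[of k] IH'
    by (intro order.trans[OF abs_triangle_ineq] add_mono) (auto simp: abs_mult intro!: mult_left_mono)
  moreover have "\<bar>poisson_weight k (L + p x)
      - (p x * poisson_weight_pred k L + (1 - p x) * poisson_weight k L)\<bar> \<le> 2 * (p x)\<^sup>2"
    using p by (intro poisson_weight_taylor) (auto simp: L_def sum_nonneg)
  ultimately have "\<bar>p x * Q' k + (1 - p x) * Q k - poisson_weight k (L + p x)\<bar> \<le> \<epsilon> + 2 * (p x)\<^sup>2"
    by (simp add: algebra_simps)
  then show ?case
    unfolding eq using insert.hyps by (simp add: L_def \<epsilon>_def algebra_simps)
qed

section \<open>Bounded differences inequality\<close>

text \<open>
  Confining \<open>g\<close> to an interval of length \<open>2c\<close> around its mean, not to one of length \<open>c\<close>, loses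
  a factor 4 in the exponent of McDiarmid's inequality, which the target bound can afford.
\<close>
lemma hoeffding_finite_pmf:
  fixes g :: "'a \<Rightarrow> real"
  assumes fin: "finite (set_pmf M)" and "s > 0" and diff: "\<And>v w. \<bar>g v - g w\<bar> \<le> c"
  shows "measure_pmf.expectation M (\<lambda>v. exp (s * (g v - measure_pmf.expectation M g)))
           \<le> exp (s\<^sup>2 * c\<^sup>2 / 2)"
proof -
  define \<mu> where "\<mu> = measure_pmf.expectation M g"
  note [intro!] = integrable_measure_pmf_finite[OF fin]
  have dev: "\<bar>g v - \<mu>\<bar> \<le> c" for v
  proof -
    \<comment> \<open>The deviation from the mean is an average of the differences
      \<open>g v - g w\<close> over \<open>w\<close>.\<close>
    have "g v - \<mu> = measure_pmf.expectation M (\<lambda>w. g v - g w)"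
      by (subst Bochner_Integration.integral_diff) (auto simp: \<mu>_def)
    also have "\<bar>\<dots>\<bar> \<le> measure_pmf.expectation M (\<lambda>w. \<bar>g v - g w\<bar>)"
      by (rule integral_abs_bound)
    also have "\<dots> \<le> measure_pmf.expectation M (\<lambda>w. c)"
      by (intro integral_mono) (auto simp: diff)
    finally show ?thesis by simp
  qed
  interpret interval_bounded_random_variable M "\<lambda>v. g v - \<mu>" "- c" c
    using dev by unfold_locales (auto intro!: AE_I2 simp: abs_le_iff minus_le_iff algebra_simps)
  have "ennreal (measure_pmf.expectation M (\<lambda>v. exp (s * (g v - \<mu>))))
      = (\<integral>\<^sup>+v. ennreal (exp (s * (g v - \<mu>))) \<partial>M)"
    by (intro nn_integral_eq_integral [symmetric]) auto
  also have "\<dots> \<le> ennreal (exp (s\<^sup>2 * (c - (- c))\<^sup>2 / 8))"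
    by (intro Hoeffdings_lemma_nn_integral_0 \<open>s > 0\<close>, subst Bochner_Integration.integral_diff)
       (auto simp: \<mu>_def)
  finally show ?thesis
    by (simp add: \<mu>_def power2_eq_square algebra_simps)
qed

text \<open>The usual martingale argument in the form of an induction. Averaging out all coordinates
  but \<open>x\<close> gives \<open>g\<close>, which still oscillates by at most \<open>c x\<close>.
  The exponential splits into the deviation of \<open>g\<close> from its mean, handled by
  Hoeffding's lemma, and the deviation of \<open>f\<close> from \<open>g v\<close> once
  \<open>x\<close> is set to \<open>v\<close>, handled by induction.\<close>

lemma bounded_differences_mgf:
  fixes f :: "('a \<Rightarrow> 'b) \<Rightarrow> real"
  assumes "finite A" "\<And>x. x \<in> A \<Longrightarrow> finite (set_pmf (q x))" "s > 0"
    and "\<And>x h v w. x \<in> A \<Longrightarrow> \<bar>f (h(x := v)) - f (h(x := w))\<bar> \<le> c x"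
  shows "measure_pmf.expectation (Pi_pmf A dflt q)
      (\<lambda>h. exp (s * (f h - measure_pmf.expectation (Pi_pmf A dflt q) f)))
    \<le> exp (s\<^sup>2 * (\<Sum>x\<in>A. (c x)\<^sup>2) / 2)"
  using assms(1,2,4)
proof (induction A arbitrary: f rule: finite_induct)
  case empty
  then show ?case by simp
next
  case (insert x A)
  let ?E = "measure_pmf.expectation (Pi_pmf A dflt q)"
  let ?Ex = "measure_pmf.expectation (q x)"
  define g where "g = (\<lambda>v. ?E (\<lambda>h. f (h(x := v))))"
  define K where "K = exp (s\<^sup>2 * (\<Sum>z\<in>A. (c z)\<^sup>2) / 2)"
  have finA: "finite (set_pmf (Pi_pmf A dflt q))"
    using insert by (intro finite_set_Pi_pmf) auto
  have finx: "finite (set_pmf (q x))"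
    using insert.prems by auto
  note [intro!] = integrable_measure_pmf_finite[OF finA] integrable_measure_pmf_finite[OF finx]
  have total: "measure_pmf.expectation (Pi_pmf (insert x A) dflt q) F
      = ?Ex (\<lambda>v. ?E (\<lambda>h. F (h(x := v))))" for F :: "_ \<Rightarrow> real"
    using insert by (intro expectation_Pi_pmf_insert) auto
  have g_diff: "\<bar>g v - g w\<bar> \<le> c x" for v w
  proof -
    have "\<bar>g v - g w\<bar> = \<bar>?E (\<lambda>h. f (h(x := v)) - f (h(x := w)))\<bar>"
      unfolding g_def by (subst Bochner_Integration.integral_diff) auto
    also have "\<dots> \<le> ?E (\<lambda>h. \<bar>f (h(x := v)) - f (h(x := w))\<bar>)"
      by (rule integral_abs_bound)
    also have "\<dots> \<le> ?E (\<lambda>h. c x)"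
      by (intro integral_mono) (auto simp: insert.prems)
    finally show ?thesis by simp
  qed
  have inner: "?E (\<lambda>h. exp (s * (f (h(x := v)) - ?Ex g))) \<le> exp (s * (g v - ?Ex g)) * K" for v
  proof -
    have "?E (\<lambda>h. exp (s * (f (h(x := v)) - ?Ex g)))
        = ?E (\<lambda>h. exp (s * (g v - ?Ex g)) * exp (s * (f (h(x := v)) - g v)))"
      by (simp add: exp_add [symmetric] algebra_simps)
    also have "\<dots> = exp (s * (g v - ?Ex g)) * ?E (\<lambda>h. exp (s * (f (h(x := v)) - g v)))"
      by simp
    also have "\<dots> \<le> exp (s * (g v - ?Ex g)) * K"
    proof (rule mult_left_mono)
      show "?E (\<lambda>h. exp (s * (f (h(x := v)) - g v))) \<le> K"
        unfolding g_def K_def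
      \<comment> \<open>The induction hypothesis is applied to the section of \<open>f\<close> at
        \<open>x := v\<close>, hence \<open>f\<close> is arbitrary. Updates at \<open>z\<close> and
        \<open>x\<close> commute, so the section inherits the bounds \<open>c z\<close>.\<close>
      proof (rule insert.IH)
        fix z h a b assume "z \<in> A"
        then have "z \<noteq> x" using insert.hyps by auto
        then show "\<bar>f ((h(z := a))(x := v)) - f ((h(z := b))(x := v))\<bar> \<le> c z"
          using insert.prems(2)[of z "h(x := v)" a b] \<open>z \<in> A\<close>
          by (simp add: fun_upd_twist[of z x] del: fun_upd_apply)
      qed (use insert.prems in auto)
    qed auto
    finally show ?thesis .
  qed
  have "measure_pmf.expectation (Pi_pmf (insert x A) dflt q)
      (\<lambda>h. exp (s * (f h - measure_pmf.expectation (Pi_pmf (insert x A) dflt q) f)))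
      = ?Ex (\<lambda>v. ?E (\<lambda>h. exp (s * (f (h(x := v)) - ?Ex g))))"
    by (simp add: total g_def)
  also have "\<dots> \<le> ?Ex (\<lambda>v. exp (s * (g v - ?Ex g)) * K)"
    by (intro integral_mono inner) auto
  also have "\<dots> = ?Ex (\<lambda>v. exp (s * (g v - ?Ex g))) * K"
    by simp
  also have "\<dots> \<le> exp (s\<^sup>2 * (c x)\<^sup>2 / 2) * K"
    by (intro mult_right_mono hoeffding_finite_pmf finx \<open>s > 0\<close> g_diff) (auto simp: K_def)
  also have "\<dots> = exp (s\<^sup>2 * (\<Sum>z\<in>insert x A. (c z)\<^sup>2) / 2)"
    using insert.hyps by (simp add: K_def exp_add [symmetric] field_simps)
  finally show ?case .
qed

lemma bounded_differences_upper_tail: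
  fixes f :: "('a \<Rightarrow> 'b) \<Rightarrow> real"
  assumes "finite A" "\<And>x. x \<in> A \<Longrightarrow> finite (set_pmf (q x))"
    and "\<And>x h v w. x \<in> A \<Longrightarrow> \<bar>f (h(x := v)) - f (h(x := w))\<bar> \<le> c x"
    and C: "C = (\<Sum>x\<in>A. (c x)\<^sup>2)" "C > 0" and "t > 0"
  shows "measure_pmf.prob (Pi_pmf A dflt q)
      {h. f h - measure_pmf.expectation (Pi_pmf A dflt q) f \<ge> t} \<le> exp (- (t\<^sup>2 / (2 * C)))"
proof -
  let ?M = "Pi_pmf A dflt q"
  let ?g = "\<lambda>h. f h - measure_pmf.expectation ?M f"
  \<comment> \<open>This \<open>s\<close> minimises the Chernoff exponent
    \<open>- s * t + s^2 * C / 2\<close>.\<close>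
  define s where "s = t / C"
  have "s > 0" using assms by (simp add: s_def)
  have fin: "finite (set_pmf ?M)"
    using assms by (intro finite_set_Pi_pmf) auto
  have "measure_pmf.prob ?M {h \<in> UNIV. ?g h \<ge> t} \<le> exp (- s * t) * (\<integral>h\<in>UNIV. exp (s * ?g h) \<partial>?M)"
    by (intro measure_pmf.Chernoff_ineq_ge \<open>s > 0\<close>)
       (auto simp: set_integrable_def intro!: integrable_measure_pmf_finite[OF fin])
  also have "(\<integral>h\<in>UNIV. exp (s * ?g h) \<partial>?M) = measure_pmf.expectation ?M (\<lambda>h. exp (s * ?g h))"
    by (simp add: set_lebesgue_integral_def)
  also have "exp (- s * t) * \<dots> \<le> exp (- s * t) * exp (s\<^sup>2 * C / 2)"
    unfolding C using assms \<open>s > 0\<close> by (intro mult_left_mono bounded_differences_mgf) auto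
  also have "\<dots> = exp (- (t\<^sup>2 / (2 * C)))"
    using \<open>C > 0\<close> by (simp add: s_def exp_add [symmetric] power2_eq_square field_simps)
  finally show ?thesis by simp
qed

text \<open>The functions \<open>f\<close> and \<open>- f\<close> have the same difference bounds,
  and a union bound joins their upper tails.\<close>

lemma bounded_differences_tail:
  fixes f :: "('a \<Rightarrow> 'b) \<Rightarrow> real"
  assumes "finite A" "\<And>x. x \<in> A \<Longrightarrow> finite (set_pmf (q x))"
    and diff: "\<And>x h v w. x \<in> A \<Longrightarrow> \<bar>f (h(x := v)) - f (h(x := w))\<bar> \<le> c x"
    and "C = (\<Sum>x\<in>A. (c x)\<^sup>2)" "C > 0" "t > 0"
  shows "measure_pmf.prob (Pi_pmf A dflt q)
      {h. \<bar>f h - measure_pmf.expectation (Pi_pmf A dflt q) f\<bar> \<ge> t} \<le> 2 * exp (- (t\<^sup>2 / (2 * C)))"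
proof -
  let ?M = "Pi_pmf A dflt q"
  let ?U = "\<lambda>f. {h. f h - measure_pmf.expectation ?M f \<ge> t}"
  have "measure_pmf.prob ?M {h. \<bar>f h - measure_pmf.expectation ?M f\<bar> \<ge> t}
      \<le> measure_pmf.prob ?M (?U f \<union> ?U (\<lambda>h. - f h))"
    by (intro measure_pmf.finite_measure_mono) auto
  also have "\<dots> \<le> measure_pmf.prob ?M (?U f) + measure_pmf.prob ?M (?U (\<lambda>h. - f h))"
    by (intro measure_subadditive) auto
  also have "\<dots> \<le> exp (- (t\<^sup>2 / (2 * C))) + exp (- (t\<^sup>2 / (2 * C)))"
  proof (intro add_mono bounded_differences_upper_tail[where c = c] assms)
    fix x h v w assume "x \<in> A"
    then show "\<bar>- f (h(x := v)) - - f (h(x := w))\<bar> \<le> c x"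
      using diff[of x h v w] by simp
  qed
  finally show ?thesis by simp
qed


section \<open>Combinatorics of choice functions and bipartite graphs\<close>

text \<open>The two updates of \<open>h\<close> have the same fibre over every \<open>y\<close>
  other than \<open>v\<close> and \<open>w\<close>, so at most two vertices enter or leave the
  count.\<close>

lemma card_fibres_of_size_diff:
  fixes h :: "'a \<Rightarrow> 'b"
  assumes "finite Y"
  shows "\<bar>real (card {y \<in> Y. card {x \<in> X. (h(z := v)) x = y} = k})
          - real (card {y \<in> Y. card {x \<in> X. (h(z := w)) x = y} = k})\<bar> \<le> 2"
proof -
  let ?A = "\<lambda>v. {y \<in> Y. card {x \<in> X. (h(z := v)) x = y} = k}"
  have "card (?A v) \<le> card (?A w) + 2" for v w
  proof -
    have "{x \<in> X. (h(z := v)) x = y} = {x \<in> X. (h(z := w)) x = y}" if "y \<notin> {v, w}" for y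
      using that by auto
    then have "?A v \<subseteq> ?A w \<union> {v, w}"
      by auto
    then have "card (?A v) \<le> card (?A w \<union> {v, w})"
      using assms by (intro card_mono) auto
    also have "\<dots> \<le> card (?A w) + card {v, w}"
      by (rule card_Un_le)
    also have "card {v, w} \<le> 2"
      by (simp add: card_insert_if)
    finally show ?thesis by simp
  qed
  from this[of v w] this[of w v] show ?thesis
    by linarith
qed

text \<open>Regularity speaks of incident edges, whereas the model draws from neighbourhoods. Every
  edge at \<open>v\<close> has two elements, so \<open>u\<close> and \<open>{v, u}\<close> determine
  each other.\<close>

lemma degree_eq_card_neighborhood:
  assumes "simple_graph G"
  shows "degree G v = card (neighborhood G v)"
proof -
  have "\<exists>u. e = {v, u}" if "e \<in> edges G" "v \<in> e" for e
  proof -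
    have "card e = 2"
      using assms that by (auto simp: simple_graph_def)
    then show ?thesis
      using that(2) by (auto simp: card_2_iff)
  qed
  then have "{e \<in> edges G. v \<in> e} = (\<lambda>u. {v, u}) ` neighborhood G v"
    by (auto simp: neighborhood_def)
  moreover have "inj_on (\<lambda>u. {v, u}) (neighborhood G v)"
    by (auto simp: inj_on_def doubleton_eq_iff)
  ultimately show ?thesis
    by (simp add: degree_def card_image)
qed

lemma neighborhood_sym: "u \<in> neighborhood G v \<longleftrightarrow> v \<in> neighborhood G u"
  by (simp add: neighborhood_def insert_commute)

lemma bipartition_neighborhood:
  assumes "bipartition G X Y"
  shows "x \<in> X \<Longrightarrow> neighborhood G x \<subseteq> Y" and "y \<in> Y \<Longrightarrow> neighborhood G y \<subseteq> X"
proof -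
  have *: "(v \<in> X \<and> u \<in> Y) \<or> (v \<in> Y \<and> u \<in> X)" if "u \<in> neighborhood G v" for u v
  proof -
    obtain x y where "x \<in> X" "y \<in> Y" "{v, u} = {x, y}"
      using assms \<open>u \<in> neighborhood G v\<close> unfolding bipartition_def neighborhood_def by blast
    then show ?thesis
      by (auto simp: doubleton_eq_iff)
  qed
  have "X \<inter> Y = {}"
    using assms by (simp add: bipartition_def)
  then show "x \<in> X \<Longrightarrow> neighborhood G x \<subseteq> Y" "y \<in> Y \<Longrightarrow> neighborhood G y \<subseteq> X"
    using * by blast+
qed

text \<open>Since \<open>y\<close> is not in \<open>X\<close>, the edge of \<open>x\<close> contains
  \<open>y\<close> exactly when \<open>f x = y\<close>. Distinct such \<open>x\<close> give distinct
  edges, so nothing is lost by collecting edges in a set.\<close>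

lemma degree_choice_graph:
  assumes "X \<inter> Y = {}" "\<And>x. x \<in> X \<Longrightarrow> f x \<in> Y" "y \<in> Y"
  shows "degree (V, (\<lambda>x. {x, f x}) ` X) y = card {x \<in> X. f x = y}"
proof -
  have "{e \<in> (\<lambda>x. {x, f x}) ` X. y \<in> e} = (\<lambda>x. {x, y}) ` {x \<in> X. f x = y}"
    using assms by blast
  moreover have "inj_on (\<lambda>x. {x, y}) {x \<in> X. f x = y}"
    using assms by (auto simp: inj_on_def doubleton_eq_iff)
  ultimately show ?thesis
    by (simp add: degree_def card_image)
qed

section \<open>The expected number of vertices of degree \<open>k\<close>\<close>

text \<open>Meant for \<open>S\<close> the neighbourhood of some \<open>y\<close> and
  \<open>w\<close> the degree: the first sum is the expected degree of \<open>y\<close> in the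
  output graph, the second expression is Le Cam's error. Between \<open>a\<close> and
  \<open>b\<close> terms, each between \<open>1 / b\<close> and \<open>1 / a\<close>, add up to
  something between \<open>a / b\<close> and \<open>b / a\<close>. The squares sum to at most
  \<open>1 / a\<close> times the first sum.\<close>

lemma inverse_sum_near_one:
  fixes w :: "'a \<Rightarrow> real"
  assumes \<delta>: "0 < \<delta>" "\<delta> \<le> 1 / 100" and d: "d \<ge> 3 / \<delta>"
    and w: "\<And>x. x \<in> S \<Longrightarrow> w x \<in> {(1 - \<delta>) * d .. (1 + \<delta>) * d}"
    and m: "real (card S) \<in> {(1 - \<delta>) * d .. (1 + \<delta>) * d}"
  shows "\<bar>(\<Sum>x\<in>S. 1 / w x) - 1\<bar> \<le> 3 * \<delta>" and "2 * (\<Sum>x\<in>S. (1 / w x)\<^sup>2) \<le> \<delta>"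
proof -
  have "d > 0" "\<delta> * d \<ge> 3"
    using d \<delta> by (auto simp: field_simps intro: less_le_trans[of 0 "3 / \<delta>"])
  define a where "a = (1 - \<delta>) * d"
  define b where "b = (1 + \<delta>) * d"
  have ab: "0 < a" "0 < b"
    using \<open>d > 0\<close> \<delta> by (auto simp: a_def b_def)
  have bounds: "1 / b \<le> 1 / w x" "1 / w x \<le> 1 / a" "0 < w x" if "x \<in> S" for x
    using w[OF that] ab by (auto simp flip: a_def b_def intro!: divide_left_mono mult_pos_pos)
  have "(\<Sum>x\<in>S. 1 / w x) \<le> (\<Sum>x\<in>S. 1 / a)"
    by (intro sum_mono bounds)
  also have "\<dots> \<le> b / a"
    using m ab by (simp add: divide_right_mono flip: a_def b_def)
  also have "\<dots> \<le> 1 + 3 * \<delta>"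
  proof -
    have "b \<le> (1 + 3 * \<delta>) * a"
    proof -
      \<comment> \<open>Equivalent to \<open>3 * \<delta>^2 \<le> \<delta>\<close>, that is, to
        \<open>\<delta> \<le> 1 / 3\<close>.\<close>
      have "1 + \<delta> \<le> (1 + 3 * \<delta>) * (1 - \<delta>)"
        using \<delta> by (simp add: algebra_simps)
      then show ?thesis
        using mult_right_mono[of "1 + \<delta>" "(1 + 3 * \<delta>) * (1 - \<delta>)" d] \<open>d > 0\<close>
        by (simp add: a_def b_def mult.assoc)
    qed
    then show ?thesis
      using ab by (simp add: field_simps)
  qed
  finally have upper: "(\<Sum>x\<in>S. 1 / w x) \<le> 1 + 3 * \<delta>" .
  have "1 - 3 * \<delta> \<le> a / b"
  proof -
    have "(1 - 3 * \<delta>) * (1 + \<delta>) \<le> 1 - \<delta>"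
      using \<delta> by (simp add: algebra_simps)
    then have "(1 - 3 * \<delta>) * b \<le> a"
      using mult_right_mono[of "(1 - 3 * \<delta>) * (1 + \<delta>)" "1 - \<delta>" d] \<open>d > 0\<close>
      by (simp add: a_def b_def mult.assoc)
    then show ?thesis
      using ab by (simp add: field_simps)
  qed
  also have "a / b \<le> (\<Sum>x\<in>S. 1 / b)"
    using m ab by (simp add: divide_right_mono flip: a_def b_def)
  also have "\<dots> \<le> (\<Sum>x\<in>S. 1 / w x)"
    by (intro sum_mono bounds)
  finally show "\<bar>(\<Sum>x\<in>S. 1 / w x) - 1\<bar> \<le> 3 * \<delta>"
    using upper by linarith
  have "(\<Sum>x\<in>S. (1 / w x)\<^sup>2) \<le> (\<Sum>x\<in>S. 1 / a * (1 / w x))"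
    unfolding power2_eq_square using bounds
    by (intro sum_mono mult_right_mono) (auto intro: less_imp_le)
  also have "\<dots> = (\<Sum>x\<in>S. 1 / w x) / a"
    by (simp add: sum_divide_distrib mult.commute)
  also have "\<dots> \<le> (1 + 3 * \<delta>) / a"
    using upper ab by (intro divide_right_mono) auto
  also have "\<dots> \<le> \<delta> / 2"
  proof -
    have "\<delta> * a = (1 - \<delta>) * (\<delta> * d)"
      by (simp add: a_def)
    also have "\<dots> \<ge> (1 - \<delta>) * 3"
      using \<delta> \<open>\<delta> * d \<ge> 3\<close> by (intro mult_left_mono) auto
    finally have "3 - 3 * \<delta> \<le> \<delta> * a"
      by simp
    \<comment> \<open>The constant 3 in \<open>d \<ge> 3 / \<delta>\<close> leaves room here:
      \<open>2 + 6 * \<delta> \<le> 3 - 3 * \<delta>\<close> for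
      \<open>\<delta> \<le> 1 / 9\<close>.\<close>
    then have "2 * (1 + 3 * \<delta>) \<le> \<delta> * a"
      using \<delta>(2) unfolding distrib_left by linarith
    then show ?thesis
      using ab by (simp add: field_simps)
  qed
  finally show "2 * (\<Sum>x\<in>S. (1 / w x)\<^sup>2) \<le> \<delta>"
    by simp
qed

text \<open>Le Cam's bound costs \<open>\<delta>\<close>; moving the Poisson parameter to 1 costs
  another \<open>3 * \<delta>\<close>.\<close>

lemma prob_in_degree_near_poisson:
  assumes H: "simple_graph H" "bipartition H X Y" "nearly_regular \<delta> d H"
    and \<delta>: "\<delta> \<le> 1 / 100" and d: "d \<ge> 3 / \<delta>" and "y \<in> Y"
  shows "\<bar>measure_pmf.prob (Pi_pmf X undefined (\<lambda>x. pmf_of_set (neighborhood H x)))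
            {f. card {x \<in> X. f x = y} = k} - exp (-1) / fact k\<bar> \<le> 4 * \<delta>"
proof -
  let ?N = "neighborhood H"
  let ?p = "\<lambda>x. measure_pmf.prob (pmf_of_set (?N x)) {y}"
  have pos: "\<delta> > 0" "d > 0"
    using H(3) by (auto simp: nearly_regular_def)
  have verts: "X \<union> Y = verts H" and fin: "finite X" "finite Y"
    using H(1,2) by (auto simp: bipartition_def simple_graph_def intro: finite_subset)
  have deg: "real (card (?N v)) \<in> {(1 - \<delta>) * d .. (1 + \<delta>) * d}" if "v \<in> X \<union> Y" for v
    using H(3) that unfolding verts
    by (auto simp: nearly_regular_def degree_eq_card_neighborhood[OF H(1)])
  have Nx: "finite (?N x)" "?N x \<noteq> {}" if "x \<in> X" for x
  proof -
    show "finite (?N x)"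
      using bipartition_neighborhood(1)[OF H(2) that] fin(2) by (rule finite_subset)
    \<comment> \<open>A positive lower bound on degrees excludes empty neighbourhoods, on which
      \<open>pmf_of_set\<close> is unspecified.\<close>
    have "(1 - \<delta>) * d > 0"
      using pos \<delta> by auto
    then show "?N x \<noteq> {}"
      using deg[of x] that by auto
  qed
  have p: "?p x = (if x \<in> ?N y then 1 / real (card (?N x)) else 0)" if "x \<in> X" for x
    using Nx[OF that] by (auto simp: measure_pmf_of_set neighborhood_sym)
  have sub: "?N y \<subseteq> X"
    using bipartition_neighborhood(2)[OF H(2) \<open>y \<in> Y\<close>] .
  \<comment> \<open>Only neighbours of \<open>y\<close> can choose \<open>y\<close>, so both sums
    shrink to \<open>?N y\<close>, whose size is controlled by regularity at
    \<open>y\<close>.\<close>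
  have sums: "(\<Sum>x\<in>X. ?p x) = (\<Sum>x\<in>?N y. 1 / real (card (?N x)))"
    "(\<Sum>x\<in>X. (?p x)\<^sup>2) = (\<Sum>x\<in>?N y. (1 / real (card (?N x)))\<^sup>2)"
    using fin sub by (auto intro!: sum.mono_neutral_cong_right simp: p subsetD)
  have near: "\<bar>(\<Sum>x\<in>X. ?p x) - 1\<bar> \<le> 3 * \<delta>" "2 * (\<Sum>x\<in>X. (?p x)\<^sup>2) \<le> \<delta>"
    unfolding sums
    by (intro inverse_sum_near_one[OF pos(1) \<delta> d] deg; use sub \<open>y \<in> Y\<close> in blast)+
  have "\<bar>measure_pmf.prob (Pi_pmf X undefined (\<lambda>x. pmf_of_set (?N x))) {f. card {x \<in> X. f x = y} = k}
      - poisson_weight k (\<Sum>x\<in>X. ?p x)\<bar> \<le> 2 * (\<Sum>x\<in>X. (?p x)\<^sup>2)"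
    using le_cam_pointwise[of X "\<lambda>x. pmf_of_set (?N x)" undefined "\<lambda>x v. v = y" k] fin Nx
    by (simp add: set_pmf_of_set)
  moreover have "\<bar>poisson_weight k (\<Sum>x\<in>X. ?p x) - poisson_weight k 1\<bar> \<le> \<bar>(\<Sum>x\<in>X. ?p x) - 1\<bar>"
    by (intro poisson_weight_lipschitz sum_nonneg) auto
  moreover have "poisson_weight k 1 = exp (-1) / fact k"
    by (simp add: poisson_weight_def)
  ultimately show ?thesis
    using near by linarith
qed

lemma expectation_card:
  assumes "finite Y" "finite (set_pmf M)"
  shows "measure_pmf.expectation M (\<lambda>f. real (card {y \<in> Y. P f y}))
    = (\<Sum>y\<in>Y. measure_pmf.prob M {f. P f y})"
proof -
  have "real (card {y \<in> Y. P f y}) = (\<Sum>y\<in>Y. of_bool (P f y))" for f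
    using assms(1) by (simp add: Int_def)
  then show ?thesis
    by (simp add: prob_eq_expectation_of_bool integrable_measure_pmf_finite[OF assms(2)]
        del: sum_of_bool_eq)
qed

section \<open>Concentration and the final bound\<close>

text \<open>The mean is within \<open>4 * \<delta> * n\<close> of the target, so a deviation above
  \<open>\<gamma> * n\<close> from the target forces one of at least
  \<open>(\<gamma> - 4 * \<delta>) * n\<close> from the mean. Bounded differences with every
  \<open>c x = 2\<close>, so \<open>C = 4 * n\<close>, gives the exponent.\<close>

lemma num_deg_concentration:
  fixes H :: "'a graph"
  assumes H: "simple_graph H" "bipartition H X Y" "nearly_regular \<delta> d H"
    and n: "card X = n" "card Y = n" "n > 0"
    and \<delta>: "\<delta> \<le> 1 / 100" and d: "d \<ge> 3 / \<delta>" and \<gamma>: "\<gamma> > 4 * \<delta>"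
  shows "measure_pmf.prob (output_graph X Y H)
            {H'. \<bar>real (num_deg k Y H') - exp (-1) / fact k * real n\<bar> > \<gamma> * real n}
          \<le> 2 * exp (- ((\<gamma> - 4 * \<delta>)\<^sup>2 / 8 * real n))"
proof -
  let ?N = "neighborhood H"
  define M where "M = Pi_pmf X undefined (\<lambda>x. pmf_of_set (?N x))"
  define I where "I = (\<lambda>f :: 'a \<Rightarrow> 'a. real (card {y \<in> Y. card {x \<in> X. f x = y} = k}))"
  define \<mu> where "\<mu> = measure_pmf.expectation M I"
  have fin: "finite X" "finite Y"
    using n by (auto intro: card_ge_0_finite)
  have disj: "X \<inter> Y = {}"
    using H(2) by (auto simp: bipartition_def)
  have Nx: "finite (?N x)" "?N x \<noteq> {}" "?N x \<subseteq> Y" if "x \<in> X" for x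
  proof -
    show sub: "?N x \<subseteq> Y"
      using bipartition_neighborhood(1)[OF H(2) that] .
    show "finite (?N x)"
      using sub fin by (auto intro: finite_subset)
    have "\<delta> > 0" "d > 0" "real (card (?N x)) \<ge> (1 - \<delta>) * d"
      using H that by (auto simp: nearly_regular_def bipartition_def degree_eq_card_neighborhood)
    moreover from this have "(1 - \<delta>) * d > 0"
      using \<delta> by auto
    ultimately show "?N x \<noteq> {}"
      by auto
  qed
  have finM: "finite (set_pmf M)"
    unfolding M_def using fin Nx by (intro finite_set_Pi_pmf) (auto simp: set_pmf_of_set)
  have num_deg: "real (num_deg k Y (X \<union> Y, (\<lambda>x. {x, f x}) ` X)) = I f" if "f \<in> set_pmf M" for f
  proof -
    have "f x \<in> Y" if "x \<in> X" for x
    proof -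
      have "f x \<in> set_pmf (pmf_of_set (?N x))"
        using \<open>f \<in> set_pmf M\<close> that fin by (auto simp: M_def set_Pi_pmf PiE_dflt_def)
      then show ?thesis
        using Nx[OF that] by (auto simp: set_pmf_of_set)
    qed
    then show ?thesis
      using degree_choice_graph[OF disj, of f] unfolding num_deg_def I_def
      by (intro arg_cong[of _ _ real] arg_cong[of _ _ card]) auto
  qed
  have "\<bar>\<mu> - exp (-1) / fact k * real n\<bar>
      = \<bar>\<Sum>y\<in>Y. measure_pmf.prob M {f. card {x \<in> X. f x = y} = k} - exp (-1) / fact k\<bar>"
    unfolding \<mu>_def I_def expectation_card[OF fin(2) finM] by (simp add: sum_subtractf n mult.commute)
  also have "\<dots> \<le> (\<Sum>y\<in>Y. 4 * \<delta>)"
    unfolding M_def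
    by (intro order.trans[OF sum_abs] sum_mono prob_in_degree_near_poisson[OF H \<delta> d])
  finally have mean: "\<bar>\<mu> - exp (-1) / fact k * real n\<bar> \<le> 4 * \<delta> * real n"
    by (simp add: n mult.commute)
  have "measure_pmf.prob (output_graph X Y H)
            {H'. \<bar>real (num_deg k Y H') - exp (-1) / fact k * real n\<bar> > \<gamma> * real n}
      \<le> measure_pmf.prob M {f. \<bar>I f - \<mu>\<bar> \<ge> (\<gamma> - 4 * \<delta>) * real n}"
    unfolding output_graph_def measure_map_pmf vimage_def M_def[symmetric]
  \<comment> \<open>Off the support of \<open>M\<close> a choice may leave \<open>Y\<close>, where
    \<open>num_deg\<close> says nothing, so the events are compared almost surely.\<close>
  proof (rule measure_pmf.finite_measure_mono_AE)
    show "AE f in M. f \<in> {f. (X \<union> Y, (\<lambda>x. {x, f x}) ` X)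
          \<in> {H'. \<bar>real (num_deg k Y H') - exp (-1) / fact k * real n\<bar> > \<gamma> * real n}}
        \<longrightarrow> f \<in> {f. \<bar>I f - \<mu>\<bar> \<ge> (\<gamma> - 4 * \<delta>) * real n}"
      unfolding AE_measure_pmf_iff using num_deg mean by (auto simp: algebra_simps)
  qed auto
  also have "\<dots> \<le> 2 * exp (- (((\<gamma> - 4 * \<delta>) * real n)\<^sup>2 / (2 * (4 * real n))))"
    unfolding \<mu>_def M_def
  proof (rule bounded_differences_tail[where c = "\<lambda>_. 2"])
    show "\<bar>I (h(x := v)) - I (h(x := w))\<bar> \<le> 2" for x h v w
      unfolding I_def by (rule card_fibres_of_size_diff[OF fin(2)])
  qed (use fin Nx n \<gamma> in \<open>auto simp: set_pmf_of_set\<close>)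
  also have "((\<gamma> - 4 * \<delta>) * real n)\<^sup>2 / (2 * (4 * real n)) = (\<gamma> - 4 * \<delta>)\<^sup>2 / 8 * real n"
    using n by (simp add: power2_eq_square)
  finally show ?thesis .
qed

theorem theorem2p1:
  fixes k :: nat and \<delta> :: real
  assumes "\<delta> \<in> {0 .. (1 / 10 ^ 8) / (fact (k + 2))\<^sup>2}"
  shows "\<exists>d\<^sub>0::real. d\<^sub>0 > 0 \<and>
    (\<forall>d::nat. real d \<ge> d\<^sub>0 \<longrightarrow>
      (\<forall>(H :: 'a graph) X Y n.
        simple_graph H \<and> bipartition H X Y \<and> nearly_regular \<delta> (real d) H \<and>
        card X = n \<and> card Y = n \<longrightarrow>
        (\<forall>\<gamma>::real. \<gamma> \<ge> 600 * (real k + 1) * sqrt \<delta> \<longrightarrow>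
          measure_pmf.prob (output_graph X Y H)
            {H'. \<bar>real (num_deg k Y H') - exp (-1) / fact k * real n\<bar> > \<gamma> * real n}
          \<le> 10 * exp (- ((\<gamma> - 600 * (real k + 1) * sqrt \<delta>)\<^sup>2 / (32 * (real k + 1)) * real n)))))"
proof -
  have "(fact (k + 2) :: real)\<^sup>2 \<ge> 1"
    by (intro one_le_power fact_ge_1)
  then have "(1 / 10 ^ 8) / (fact (k + 2) :: real)\<^sup>2 \<le> (1 / 10 ^ 8) / 1"
    by (intro divide_left_mono) auto
  also have "\<dots> \<le> (1 / 100 :: real)"
    by simp
  finally have "(1 / 10 ^ 8) / (fact (k + 2))\<^sup>2 \<le> (1 / 100 :: real)" .
  then have \<delta>: "0 \<le> \<delta>" "\<delta> \<le> 1 / 100"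
    using assms unfolding atLeastAtMost_iff by (blast, blast intro: order.trans)
  show ?thesis
  \<comment> \<open>The summand 1 keeps the witness positive at \<open>\<delta> = 0\<close>, where
    \<open>3 / \<delta>\<close> evaluates to 0.\<close>
  proof (intro exI[of _ "3 / \<delta> + 1"] conjI allI impI)
    show "3 / \<delta> + 1 > 0"
      using \<delta> by (simp add: add_nonneg_pos)
  next
    fix d :: nat and H :: "'a graph" and X Y n and \<gamma> :: real
    assume d: "3 / \<delta> + 1 \<le> real d"
      and "simple_graph H \<and> bipartition H X Y \<and> nearly_regular \<delta> (real d) H \<and>
        card X = n \<and> card Y = n"
      and \<gamma>: "600 * (real k + 1) * sqrt \<delta> \<le> \<gamma>"
    then have H: "simple_graph H" "bipartition H X Y" "nearly_regular \<delta> (real d) H"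
      and n: "card X = n" "card Y = n"
      by auto
    let ?\<beta> = "600 * (real k + 1) * sqrt \<delta>"
    let ?p = "measure_pmf.prob (output_graph X Y H)
      {H'. \<bar>real (num_deg k Y H') - exp (-1) / fact k * real n\<bar> > \<gamma> * real n}"
    \<comment> \<open>Positivity is part of \<open>nearly_regular\<close>, so
      \<open>\<delta> = 0\<close> is vacuous.\<close>
    have "\<delta> > 0"
      using H(3) by (simp add: nearly_regular_def)
    have "\<delta> \<le> sqrt \<delta>"
      using \<delta> by (intro real_le_rsqrt) (simp add: power2_eq_square mult_left_le)
    moreover have "4 * sqrt \<delta> < ?\<beta>"
      using \<open>\<delta> > 0\<close> by (intro mult_strict_right_mono) auto
    ultimately have \<beta>: "4 * \<delta> < ?\<beta>"
      by linarith
    show "?p \<le> 10 * exp (- ((\<gamma> - ?\<beta>)\<^sup>2 / (32 * (real k + 1)) * real n))"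
    \<comment> \<open>For \<open>n = 0\<close> the right-hand side is 10, above any probability; the
      concentration lemma asks for \<open>n > 0\<close>.\<close>
    proof (cases "n = 0")
      case True
      have "?p \<le> 1"
        by (rule measure_pmf.prob_le_1)
      also have "1 \<le> 10 * exp (- ((\<gamma> - ?\<beta>)\<^sup>2 / (32 * (real k + 1)) * real n))"
        using True by simp
      finally show ?thesis .
    next
      case False
      have "?p \<le> 2 * exp (- ((\<gamma> - 4 * \<delta>)\<^sup>2 / 8 * real n))"
        using False d \<beta> \<gamma> \<delta> by (intro num_deg_concentration[OF H n]) auto
      also have "\<dots> \<le> 10 * exp (- ((\<gamma> - ?\<beta>)\<^sup>2 / (32 * (real k + 1)) * real n))"
      proof (intro mult_mono)
        \<comment> \<open>From \<open>4 * \<delta> < ?\<beta> \<le> \<gamma>\<close> the numerator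
          grows, and \<open>8 \<le> 32 * (real k + 1)\<close>, so the denominator shrinks.\<close>
        have "(\<gamma> - ?\<beta>)\<^sup>2 / (32 * (real k + 1)) \<le> (\<gamma> - 4 * \<delta>)\<^sup>2 / 8"
          using \<beta> \<gamma> by (intro frac_le power_mono) auto
        then show "exp (- ((\<gamma> - 4 * \<delta>)\<^sup>2 / 8 * real n))
            \<le> exp (- ((\<gamma> - ?\<beta>)\<^sup>2 / (32 * (real k + 1)) * real n))"
          unfolding exp_le_cancel_iff neg_le_iff_le by (rule mult_right_mono) simp
      qed auto
      finally show ?thesis .
    qed
  qed
qed

end
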